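(* Let $K$ be a locally compact Hausdorff space. Then the following are equivalent: (i) $C_0(K)$ has the BCP; (ii) $K$ has a countable $\pi$-basis; (iii) $C_0(K)$ has the UBCP.
   Context: $C_0(K)$ is the Banach space of scalar-valued continuous functions on $K$ vanishing at infinity, with the supremum norm. A $\pi$-basis of a topological space $K$ is a collection $\mathcal U$ of nonempty open subsets of $K$ such that every nonempty open subset of $K$ contains some member of $\mathcal U$. A normed space $X$ has the ball-covering property (BCP) if its unit sphere $S_X=\{x:\|x\|=1\}$ can be covered by countably many closed (equivalently, open) balls, none of which contains the origin. $X$ has the strong ball-covering property (SBCP) if such a countable cover $\{B_n\}$ of $S_X$ by balls not containing the origin can be chosen so that the radii form a bounded sequence. $X$ has the uniform ball-covering property (UBCP) if there is a countable cover $\{B_n\}$ of $S_X$ by balls not containing the origin, with bounded radii, for which there also exists an open ball $B_0$ containing the origin with $B_n\cap B_0=\emptyset$ for all $n$. *)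

theory Defs
  imports "HOL-Analysis.Analysis"
begin

text \<open>The type of bounded continuous functions carries the supremum norm, so \<open>C0\<close>
  is a normed space as a linear subspace of it. Continuous functions vanishing at infinity are
  automatically bounded.\<close>

definition C0 :: "('a::topological_space \<Rightarrow>\<^sub>C 'b::real_normed_vector) set" where
  "C0 = {f :: 'a \<Rightarrow>\<^sub>C 'b. \<forall>e>0. compact {x. e \<le> norm (f x)}}"

lemma subspace_C0: "subspace (C0 :: ('a::topological_space \<Rightarrow>\<^sub>C 'b::real_normed_vector) set)"
proof (rule subspaceI)
  show "(0 :: 'a \<Rightarrow>\<^sub>C 'b) \<in> C0"
    by (auto simp: C0_def)
next
  fix f g :: "'a \<Rightarrow>\<^sub>C 'b"
  assume fg: "f \<in> C0" "g \<in> C0"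
  show "f + g \<in> C0"
    unfolding C0_def
  proof (intro CollectI allI impI)
    fix e :: real
    assume "e > 0"
    then have c: "compact ({x. e/2 \<le> norm (f x)} \<union> {x. e/2 \<le> norm (g x)})"
      using fg half_gt_zero[of e] unfolding C0_def by (intro compact_Un) blast+
    have cl: "closed {x. e \<le> norm ((f + g) x)}"
      by (intro closed_Collect_le continuous_on_const continuous_on_norm continuous_on_apply_bcontfun)
    have "e/2 \<le> norm (f x) \<or> e/2 \<le> norm (g x)" if "e \<le> norm (f x + g x)" for x
      using norm_triangle_ineq[of "f x" "g x"] that by linarith
    then have "({x. e/2 \<le> norm (f x)} \<union> {x. e/2 \<le> norm (g x)}) \<inter> {x. e \<le> norm ((f + g) x)}
        = {x. e \<le> norm ((f + g) x)}"
      by auto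
    then show "compact {x. e \<le> norm ((f + g) x)}"
      using compact_Int_closed[OF c cl] by simp
  qed
next
  fix a :: real and f :: "'a \<Rightarrow>\<^sub>C 'b"
  assume f: "f \<in> C0"
  show "a *\<^sub>R f \<in> C0"
  proof (cases "a = 0")
    case True
    then show ?thesis by (auto simp: C0_def)
  next
    case False
    then have "{x. e \<le> norm ((a *\<^sub>R f) x)} = {x. e / \<bar>a\<bar> \<le> norm (f x)}" for e
      by (auto simp: field_simps)
    moreover have "compact {x. e / \<bar>a\<bar> \<le> norm (f x)}" if "e > 0" for e
      using f False that divide_pos_pos[of e "\<bar>a\<bar>"] unfolding C0_def by auto
    ultimately show ?thesis
      by (simp add: C0_def)
  qed
qed

definition pi_basis :: "'a::topological_space set set \<Rightarrow> bool" where
  "pi_basis \<U> \<longleftrightarrow> (\<forall>U\<in>\<U>. open U \<and> U \<noteq> {}) \<and>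
    (\<forall>V. open V \<and> V \<noteq> {} \<longrightarrow> (\<exists>U\<in>\<U>. U \<subseteq> V))"

text \<open>In what follows the normed space is a linear subspace \<open>X\<close> of a type of class
  \<open>real_normed_vector\<close>: centres of balls lie in \<open>X\<close>, and balls of \<open>X\<close> are the traces on \<open>X\<close> of
  the ambient balls. A countable family of closed balls is given by a countable
  set \<open>B\<close> of pairs (centre, radius).\<close>

definition ball_cover :: "'v::real_normed_vector set \<Rightarrow> ('v \<times> real) set \<Rightarrow> bool" where
  "ball_cover X B \<longleftrightarrow> countable B \<and>
    (\<forall>(c, r)\<in>B. c \<in> X \<and> r > 0 \<and> 0 \<notin> X \<inter> cball c r) \<and>
    {x \<in> X. norm x = 1} \<subseteq> (\<Union>(c, r)\<in>B. X \<inter> cball c r)"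

definition BCP :: "'v::real_normed_vector set \<Rightarrow> bool" where
  "BCP X \<longleftrightarrow> (\<exists>B. ball_cover X B)"

definition UBCP :: "'v::real_normed_vector set \<Rightarrow> bool" where
  "UBCP X \<longleftrightarrow> (\<exists>B. ball_cover X B \<and> (\<exists>R. \<forall>(c, r)\<in>B. r \<le> R) \<and>
    (\<exists>c0\<in>X. \<exists>r0. 0 \<in> X \<inter> ball c0 r0 \<and>
      (\<forall>(c, r)\<in>B. (X \<inter> cball c r) \<inter> (X \<inter> ball c0 r0) = {})))"

end

(* If cball c r misses the origin then norm c > r, so {x. norm (c x) > r} is a nonempty open set.
   A bump function of norm one supported in an open set V lies in some ball of a countable cover;
   off V it vanishes, so there norm (c x) \<le> r. Hence these sets form a countable pi-basis.

   Conversely, let f be a bump function supported in a member U of a pi-basis, and s a nearly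
   unit vector from a countable dense set of scalars. A function g of norm one stays close to such
   an s on some U, and then g - 4 f s has norm about 3: on U because g is close to s and 4 f takes
   values in [0, 4], off U because f vanishes. The centre 4 f s has norm about 4, which leaves
   room for a ball around the origin. *)

theory Submission
  imports Defs
begin

lemma norm_apply_le_norm_bcontfun: "norm (apply_bcontfun f x) \<le> norm f"
  using dist_bounded[of f x 0] by (simp add: dist_norm)

text \<open>A locally compact Hausdorff space is completely regular, which yields a Urysohn function
  at \<open>x\<close>. The scalar profile \<open>\<phi>\<close> is returned along with
  \<open>f\<close> because later estimates are made on \<open>\<phi>\<close>.\<close>

lemma C0_bump:
  fixes U :: "'a::t2_space set" and v :: "'b::real_normed_vector"
  assumes lc: "locally_compact_space (euclidean :: 'a topology)"
    and "open U" "x \<in> U"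
  obtains f :: "'a \<Rightarrow>\<^sub>C 'b" and \<phi> :: "'a \<Rightarrow> real"
  where "f \<in> C0" "\<And>y. apply_bcontfun f y = \<phi> y *\<^sub>R v" "\<And>y. 0 \<le> \<phi> y" "\<And>y. \<phi> y \<le> 1" "\<phi> x = 1"
    "\<And>y. y \<notin> U \<Longrightarrow> \<phi> y = 0"
proof -
  obtain V L where V: "open V" "compact L" "x \<in> V" "V \<subseteq> L"
    using lc unfolding locally_compact_space_def by simp metis
  have "Hausdorff_space (euclidean :: 'a topology)"
    unfolding Hausdorff_space_def disjnt_def by simp (metis hausdorff)
  then have "completely_regular_space (euclidean :: 'a topology)"
    using lc locally_compact_regular_imp_completely_regular_space by blast
  \<comment> \<open>Separating \<open>x\<close> from the complement of \<open>U \<inter> V\<close>,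
    rather than of \<open>U\<close>, forces the bump to vanish off the compact set \<open>L\<close>;
    this is what puts \<open>f\<close> into \<open>C0\<close>.\<close>
  moreover have "closedin euclidean (- (U \<inter> V))" "x \<in> topspace euclidean - (- (U \<inter> V))"
    using assms V by (auto simp: closed_Compl)
  ultimately obtain h :: "'a \<Rightarrow> real"
    where h: "continuous_map euclidean (top_of_set {0..1}) h" "h x = 0" "h ` (- (U \<inter> V)) \<subseteq> {1}"
    unfolding completely_regular_space_def by meson
  have hc: "continuous_on UNIV h" and h01: "\<And>y. 0 \<le> h y" "\<And>y. h y \<le> 1"
    using h(1) by (auto simp: continuous_map_in_subtopology)
  define \<phi> where "\<phi> = (\<lambda>y. 1 - h y)"
  have cont: "continuous_on UNIV (\<lambda>y. \<phi> y *\<^sub>R v)"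
    unfolding \<phi>_def by (intro continuous_intros hc)
  have "norm (\<phi> y *\<^sub>R v) \<le> norm v" for y
    using h01[of y] by (simp add: \<phi>_def mult_left_le_one_le)
  with cont have "(\<lambda>y. \<phi> y *\<^sub>R v) \<in> bcontfun"
    by (rule bcontfun_normI)
  then obtain f :: "'a \<Rightarrow>\<^sub>C 'b" where f: "apply_bcontfun f = (\<lambda>y. \<phi> y *\<^sub>R v)"
    by (metis bcontfun.Bcontfun_inverse)
  have off: "\<phi> y = 0" if "y \<notin> U \<inter> V" for y
    using h(3) that by (auto simp: \<phi>_def)
  have "compact {y. e \<le> norm (f y)}" if "e > 0" for e
  proof -
    have "closed {y. e \<le> norm (f y)}"
      by (intro closed_Collect_le continuous_on_const continuous_on_norm continuous_on_apply_bcontfun)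
    moreover have "{y. e \<le> norm (f y)} \<subseteq> L"
    proof
      fix y assume "y \<in> {y. e \<le> norm (f y)}"
      then have "\<phi> y \<noteq> 0" using that by (auto simp: f)
      then show "y \<in> L" using off V(4) by blast
    qed
    ultimately show ?thesis
      using compact_Int_closed[OF V(2)] by (metis inf.absorb_iff2)
  qed
  then have "f \<in> C0" by (simp add: C0_def)
  then show ?thesis
    by (rule that[of f \<phi>]) (use f off h01 h(2) in \<open>auto simp: \<phi>_def\<close>)
qed

lemma UBCP_imp_BCP: "UBCP X \<Longrightarrow> BCP X"
  by (auto simp: UBCP_def BCP_def)

text \<open>The class \<open>perfect_space\<close> excludes the zero space of scalars: over it the
  unit sphere is empty and \<open>BCP\<close> holds for every space. It supplies the unit vector
  that scales the bump.\<close>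

lemma BCP_C0_imp_countable_pi_basis:
  assumes lc: "locally_compact_space (euclidean :: 'a::t2_space topology)"
    and bcp: "BCP (C0 :: ('a \<Rightarrow>\<^sub>C 'b::{real_normed_vector, perfect_space}) set)"
  shows "\<exists>\<U> :: 'a set set. countable \<U> \<and> pi_basis \<U>"
proof -
  obtain B :: "(('a \<Rightarrow>\<^sub>C 'b) \<times> real) set" where cnt: "countable B"
    and B: "\<And>c r. (c, r) \<in> B \<Longrightarrow> r > 0 \<and> 0 \<notin> C0 \<inter> cball c r"
    and cover: "{f \<in> C0. norm f = 1} \<subseteq> (\<Union>(c, r)\<in>B. C0 \<inter> cball c r)"
    using bcp unfolding BCP_def ball_cover_def by fast
  define N where "N = (\<lambda>(c :: 'a \<Rightarrow>\<^sub>C 'b, r). {x. r < norm (c x)})"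
  have "open (N p) \<and> N p \<noteq> {}" if "p \<in> B" for p
  proof (cases p)
    case (Pair c r)
    have "open {x. r < norm (c x)}"
      by (intro open_Collect_less continuous_on_const continuous_on_norm continuous_on_apply_bcontfun)
    moreover have "r < norm c"
      using B[of c r] that subspace_0[OF subspace_C0] by (auto simp: Pair)
    \<comment> \<open>A pointwise bound by \<open>r\<close> would bound the supremum norm by
      \<open>r\<close>.\<close>
    then have "\<exists>x. r < norm (c x)"
      using norm_bound[of c r] by (meson not_le)
    ultimately show ?thesis by (simp add: N_def Pair)
  qed
  moreover have "\<exists>p\<in>B. N p \<subseteq> V" if "open V" "V \<noteq> {}" for V
  proof -
    from that obtain x where "x \<in> V" by blast
    obtain v :: 'b where v: "norm v = 1"
      using vector_choose_size[of 1] by auto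
    obtain f :: "'a \<Rightarrow>\<^sub>C 'b" and \<phi> where f: "f \<in> C0" "\<And>y. apply_bcontfun f y = \<phi> y *\<^sub>R v"
      "\<And>y. 0 \<le> \<phi> y" "\<And>y. \<phi> y \<le> 1" "\<phi> x = 1" "\<And>y. y \<notin> V \<Longrightarrow> \<phi> y = 0"
      using C0_bump[OF lc \<open>open V\<close> \<open>x \<in> V\<close>] by metis
    have "norm f \<le> 1"
      by (rule norm_bound) (simp add: f v)
    moreover have "1 \<le> norm f"
      using norm_apply_le_norm_bcontfun[of f x] by (simp add: f v)
    ultimately have "f \<in> {f \<in> C0. norm f = 1}" using f(1) by simp
    then obtain c r where cr: "(c, r) \<in> B" "norm (c - f) \<le> r"
      using cover by (auto simp: dist_norm)
    have "x \<in> V" if "r < norm (c x)" for x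
    proof (rule ccontr)
      assume "x \<notin> V"
      then have "norm (c x) \<le> norm (c - f)"
        using norm_apply_le_norm_bcontfun[of "c - f" x] by (simp add: f)
      then show False using cr(2) that by linarith
    qed
    then show ?thesis
      by (intro bexI[OF _ cr(1)]) (auto simp: N_def)
  qed
  ultimately have "pi_basis (N ` B)"
    unfolding pi_basis_def by simp
  moreover have "countable (N ` B)"
    using cnt by (rule countable_image)
  ultimately show ?thesis by metis
qed

text \<open>Second countability of the scalars gives the countable dense set of values. One bump is
  fixed in advance for each pair of a member of \<open>\<U>\<close> and a value, so the centres form
  a countable family.\<close>

lemma countable_pi_basis_imp_UBCP_C0:
  fixes \<U> :: "'a::t2_space set set"
  assumes lc: "locally_compact_space (euclidean :: 'a topology)"
    and cnt: "countable \<U>" and pi: "pi_basis \<U>"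
  shows "UBCP (C0 :: ('a \<Rightarrow>\<^sub>C 'b::{real_normed_vector, second_countable_topology}) set)"
proof -
  obtain D :: "'b set" where D: "countable D" "\<And>X. open X \<Longrightarrow> X \<noteq> {} \<Longrightarrow> \<exists>d\<in>D. d \<in> X"
    using countable_dense_exists by blast
  \<comment> \<open>The lower bound gives centres of norm at least 4 * 15/16 = 15/4, above the
    radius 7/2. The upper bound keeps the error on \<open>U\<close> below 3 * 17/16 + 1/32 = 103/32,
    under 7/2.\<close>
  define S where "S = {s \<in> D. 15/16 \<le> norm s \<and> norm s \<le> 17/16}"
  define P where "P U s f \<longleftrightarrow> f \<in> C0 \<and> (\<exists>\<phi> x. (\<forall>y. apply_bcontfun f y = \<phi> y *\<^sub>R s) \<and>
      (\<forall>y. 0 \<le> \<phi> y \<and> \<phi> y \<le> 1) \<and> \<phi> x = (1::real) \<and> (\<forall>y. y \<notin> U \<longrightarrow> \<phi> y = 0))"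
    for U and s :: 'b and f :: "'a \<Rightarrow>\<^sub>C 'b"
  define F where "F U s = (SOME f. P U s f)" for U s
  have F: "P U s (F U s)" if U: "U \<in> \<U>" for U s
  proof -
    obtain x where x: "open U" "x \<in> U" using U pi unfolding pi_basis_def by blast
    have "\<exists>f. P U s f"
    proof (rule C0_bump[OF lc x, where v = s])
      fix f :: "'a \<Rightarrow>\<^sub>C 'b" and \<phi> :: "'a \<Rightarrow> real"
      assume "f \<in> C0" "\<And>y. apply_bcontfun f y = \<phi> y *\<^sub>R s" "\<And>y. 0 \<le> \<phi> y" "\<And>y. \<phi> y \<le> 1" "\<phi> x = 1"
        "\<And>y. y \<notin> U \<Longrightarrow> \<phi> y = 0"
      then show ?thesis unfolding P_def by blast
    qed
    then show ?thesis unfolding F_def by (rule someI_ex)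
  qed
  define B where "B = (\<lambda>(U, s). (4 *\<^sub>R F U s, 7/2 :: real)) ` (\<U> \<times> S)"
  have centre: "c \<in> C0 \<and> r = 7/2 \<and> 15/4 \<le> norm c" if "(c, r) \<in> B" for c r
  proof -
    obtain U s where U: "U \<in> \<U>" "s \<in> S" and c: "c = 4 *\<^sub>R F U s" "r = 7/2"
      using \<open>(c, r) \<in> B\<close> by (auto simp: B_def)
    obtain \<phi> x where \<phi>: "F U s \<in> C0" "apply_bcontfun (F U s) x = \<phi> x *\<^sub>R s" "\<phi> x = (1::real)"
      using F[OF U(1)] unfolding P_def by blast
    have "15/16 \<le> norm s" using U by (simp add: S_def)
    also have "\<dots> \<le> norm (F U s)"
      using norm_apply_le_norm_bcontfun[of "F U s" x] by (simp add: \<phi>)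
    finally show ?thesis
      using \<phi>(1) c by (simp add: subspace_scale[OF subspace_C0])
  qed
  have cover: "\<exists>(c, r)\<in>B. g \<in> cball c r" if g: "norm g = 1" for g :: "'a \<Rightarrow>\<^sub>C 'b"
  proof -
    \<comment> \<open>With an approximation error of 1/32, a value of norm in (31/32, 1] leads to
      some \<open>s\<close> of norm between 15/16 and 17/16, that is, in \<open>S\<close>.\<close>
    have "\<exists>x. 31/32 < norm (g x)"
      using norm_bound[of g "31/32"] g by (force simp: not_le)
    then obtain x where x: "31/32 < norm (g x)" "norm (g x) \<le> 1"
      using norm_apply_le_norm_bcontfun[of g] by (auto simp: g)
    obtain s where s: "s \<in> D" "norm (g x - s) < 1/32"
      using D(2)[of "ball (apply_bcontfun g x) (1/32)"] by (auto simp: dist_norm)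
    have sS: "s \<in> S"
      using x s norm_triangle_ineq2[of "g x" s] norm_triangle_ineq2[of s "g x"]
      by (simp add: S_def norm_minus_commute)
    have "open {y. norm (g y - s) < 1/32}"
      by (intro open_Collect_less continuous_intros continuous_on_apply_bcontfun)
    \<comment> \<open>The open set is nonempty because it contains \<open>x\<close>. The member
      \<open>U\<close> may miss \<open>x\<close>: only the closeness of \<open>g\<close> to
      \<open>s\<close> on all of \<open>U\<close> matters.\<close>
    then obtain U where U: "U \<in> \<U>" "U \<subseteq> {y. norm (g y - s) < 1/32}"
      using pi s unfolding pi_basis_def by blast
    obtain \<phi> where \<phi>: "\<And>y. apply_bcontfun (F U s) y = \<phi> y *\<^sub>R s" "\<And>y. 0 \<le> \<phi> y" "\<And>y. \<phi> y \<le> (1::real)"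
        "\<And>y. y \<notin> U \<Longrightarrow> \<phi> y = 0"
      using F[OF U(1), of s] unfolding P_def by blast
    have "norm ((4 *\<^sub>R F U s - g) y) \<le> 7/2" for y
    proof (cases "y \<in> U")
      case True
      \<comment> \<open>Splitting off \<open>s\<close> isolates the factor
        \<open>4 * \<phi> y - 1\<close>, which lies in [-1, 3] and so has absolute value at most
        3.\<close>
      have eq: "(4 *\<^sub>R F U s - g) y = (4 * \<phi> y - 1) *\<^sub>R s - (g y - s)"
        by (simp add: \<phi> algebra_simps)
      have "\<bar>4 * \<phi> y - 1\<bar> * norm s \<le> 3 * (17/16)"
        using \<phi>(2,3)[of y] sS by (intro mult_mono) (auto simp: S_def)
      moreover have "norm (g y - s) < 1/32" using True U by blast
      ultimately show ?thesis
        using norm_triangle_ineq4[of "(4 * \<phi> y - 1) *\<^sub>R s" "g y - s"] unfolding eq by simp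
    next
      case False
      then show ?thesis
        using norm_apply_le_norm_bcontfun[of g y] g by (simp add: \<phi> False)
    qed
    then have "norm (4 *\<^sub>R F U s - g) \<le> 7/2" by (rule norm_bound)
    moreover have "(4 *\<^sub>R F U s, 7/2) \<in> B"
      using U(1) sS by (auto simp: B_def)
    ultimately show ?thesis
      by (intro bexI[of _ "(4 *\<^sub>R F U s, 7/2)"]) (auto simp: dist_norm)
  qed
  have "countable B"
    unfolding B_def S_def using cnt D(1) by auto
  then have "ball_cover C0 B"
    unfolding ball_cover_def
  proof (intro conjI)
    show "\<forall>(c, r)\<in>B. c \<in> C0 \<and> 0 < r \<and> 0 \<notin> C0 \<inter> cball c r"
      using centre by (force simp: dist_norm)
    show "{g \<in> C0. norm g = 1} \<subseteq> (\<Union>(c, r)\<in>B. C0 \<inter> cball c r)"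
      using cover by blast
  qed
  moreover have "\<forall>(c, r)\<in>B. r \<le> 7/2"
    using centre by auto
  moreover have "0 \<in> C0 \<inter> ball (0 :: 'a \<Rightarrow>\<^sub>C 'b) (1/4)"
    using subspace_0[OF subspace_C0] by simp
  moreover have "(C0 \<inter> cball c r) \<inter> (C0 \<inter> ball 0 (1/4)) = {}" if "(c, r) \<in> B" for c r
  proof -
    \<comment> \<open>Otherwise \<open>norm c\<close> would be less than 7/2 + 1/4 = 15/4, the lower
      bound for the norms of the centres.\<close>
    have False if "norm (c - g) \<le> r" "norm g < 1/4" for g
      using centre[OF \<open>(c, r) \<in> B\<close>] that norm_triangle_sub[of c g] by linarith
    then show ?thesis by (auto simp: dist_norm)
  qed
  then have "\<forall>(c, r)\<in>B. (C0 \<inter> cball c r) \<inter> (C0 \<inter> ball 0 (1/4)) = {}"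
    by blast
  ultimately show ?thesis
    unfolding UBCP_def using subspace_0[OF subspace_C0] by meson
qed

text \<open>The implications close a cycle through \<open>BCP\<close>, a countable \<pi>-basis and
  \<open>UBCP\<close>. The scalar type stays general so that the real and the complex case are both
  instances.\<close>

lemma BCP_UBCP_C0_iff_countable_pi_basis:
  assumes lc: "locally_compact_space (euclidean :: 'a::t2_space topology)"
  defines "X \<equiv> C0 :: ('a \<Rightarrow>\<^sub>C 'b::{real_normed_vector, perfect_space, second_countable_topology}) set"
  shows "(BCP X \<longleftrightarrow> (\<exists>\<U> :: 'a set set. countable \<U> \<and> pi_basis \<U>)) \<and>
    ((\<exists>\<U> :: 'a set set. countable \<U> \<and> pi_basis \<U>) \<longleftrightarrow> UBCP X)"
proof -
  have "BCP X \<Longrightarrow> \<exists>\<U> :: 'a set set. countable \<U> \<and> pi_basis \<U>"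
    unfolding X_def by (rule BCP_C0_imp_countable_pi_basis[OF lc])
  moreover have "UBCP X" if "\<exists>\<U> :: 'a set set. countable \<U> \<and> pi_basis \<U>"
    using that countable_pi_basis_imp_UBCP_C0[OF lc] unfolding X_def by auto
  moreover have "UBCP X \<Longrightarrow> BCP X"
    by (rule UBCP_imp_BCP)
  ultimately show ?thesis by argo
qed

theorem theorem2p1:
  assumes "locally_compact_space (euclidean :: 'a::t2_space topology)"
  shows "((BCP (C0 :: ('a \<Rightarrow>\<^sub>C real) set) \<longleftrightarrow> (\<exists>\<U> :: 'a set set. countable \<U> \<and> pi_basis \<U>)) \<and>
       ((\<exists>\<U> :: 'a set set. countable \<U> \<and> pi_basis \<U>) \<longleftrightarrow> UBCP (C0 :: ('a \<Rightarrow>\<^sub>C real) set))) \<and>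
      ((BCP (C0 :: ('a \<Rightarrow>\<^sub>C complex) set) \<longleftrightarrow> (\<exists>\<U> :: 'a set set. countable \<U> \<and> pi_basis \<U>)) \<and>
       ((\<exists>\<U> :: 'a set set. countable \<U> \<and> pi_basis \<U>) \<longleftrightarrow> UBCP (C0 :: ('a \<Rightarrow>\<^sub>C complex) set)))"
  by (intro conjI[OF BCP_UBCP_C0_iff_countable_pi_basis BCP_UBCP_C0_iff_countable_pi_basis] assms)

end
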